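(* Let $k$ be a positive integer and let $G$ be the $(6k-1)\times(6k-1)$ grid graph. Then the answer to the Most Clicks Problem on $G$ is at most $26k^2 - 12k + 1$. Moreover, if $d(6k-1) = 2$, the answer to the Most Clicks Problem on $G$ is exactly $26k^2 - 12k + 1$.
   Context: The $m\times m$ grid graph has the cells of an $m\times m$ array as vertices, two being adjacent when they share a side. For a graph $G=(V,E)$ and $v\in V$ let $N[v]$ be the closed neighborhood of $v$, and define $\Phi_G(S) = \{v \in V : \lvert N[v]\cap S\rvert \text{ odd}\}$ for $S\subseteq V$ (the set of lights toggled when each vertex of $S$ is clicked once, clicking a vertex toggling it and its neighbors). An initial configuration $C\subseteq V$ (lights that are on) is solvable if $C = \Phi_G(S)$ for some $S$, called a solution; its minimum number of clicks is $\min\{\lvert S\rvert : \Phi_G(S) = C\}$. The Most Clicks Problem asks for the maximum, over all solvable initial configurations $C$, of the minimum number of clicks needed to solve $C$. $d(m)$ denotes $\dim_{\mathbb{F}_2}\ker \Phi_G$ for $G$ the $m\times m$ grid graph. *)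

theory Defs
  imports Complex_Main "HOL-Library.Z2" "HOL-Library.Function_Algebras"
begin

type_synonym 'v graph = "'v set \<times> 'v set set"

abbreviation verts :: "'v graph \<Rightarrow> 'v set" where
  "verts G \<equiv> fst G"

abbreviation edges :: "'v graph \<Rightarrow> 'v set set" where
  "edges G \<equiv> snd G"

definition closed_nbhd :: "'v graph \<Rightarrow> 'v \<Rightarrow> 'v set" where
  "closed_nbhd G v = insert v {w \<in> verts G. {v, w} \<in> edges G}"

definition toggled :: "'v graph \<Rightarrow> 'v set \<Rightarrow> 'v set" where
  "toggled G S = {v \<in> verts G. odd (card (closed_nbhd G v \<inter> S))}"

definition solutions :: "'v graph \<Rightarrow> 'v set \<Rightarrow> 'v set set" where
  "solutions G C = {S. S \<subseteq> verts G \<and> toggled G S = C}"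

definition solvable :: "'v graph \<Rightarrow> 'v set \<Rightarrow> bool" where
  "solvable G C \<longleftrightarrow> solutions G C \<noteq> {}"

text \<open>For finite graphs the sets under \<open>Min\<close> (with \<open>C\<close> solvable) and \<open>Max\<close>
  are finite and nonempty; the empty configuration is always solvable.\<close>

definition min_clicks :: "'v graph \<Rightarrow> 'v set \<Rightarrow> nat" where
  "min_clicks G C = Min (card ` solutions G C)"

definition most_clicks :: "'v graph \<Rightarrow> nat" where
  "most_clicks G = Max (min_clicks G ` {C. C \<subseteq> verts G \<and> solvable G C})"

definition grid_graph :: "nat \<Rightarrow> (nat \<times> nat) graph" where
  "grid_graph m =
    (let V = {..<m} \<times> {..<m} in
      (V, {{(i, j), (i', j')} | i j i' j'. (i, j) \<in> V \<and> (i', j') \<in> V \<and>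
             (i' = i \<and> j' = Suc j \<or> i' = Suc i \<and> j' = j)}))"

text \<open>Subsets of the vertex set with symmetric difference form a vector space over the
  two-element field \<^typ>\<open>bit\<close>; a subset is identified with its indicator function.\<close>

definition scale_F2 :: "bit \<Rightarrow> ('v \<Rightarrow> bit) \<Rightarrow> 'v \<Rightarrow> bit" where
  "scale_F2 c f = (\<lambda>v. c * f v)"

lemma vector_space_F2: "vector_space scale_F2"
  by unfold_locales (auto simp: scale_F2_def fun_eq_iff algebra_simps)

definition indicator_F2 :: "'v set \<Rightarrow> 'v \<Rightarrow> bit" where
  "indicator_F2 S = (\<lambda>v. of_bool (v \<in> S))"

definition kernel_dim :: "'v graph \<Rightarrow> nat" where
  "kernel_dim G = vector_space.dim scale_F2 (indicator_F2 ` {S. S \<subseteq> verts G \<and> toggled G S = {}})"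

definition d_grid :: "nat \<Rightarrow> nat" where
  "d_grid m = kernel_dim (grid_graph m)"

end

theory Submission
  imports Defs
begin

text \<open>Numbering the cells from \<open>1\<close>, the sets \<open>P = {(i, j). \<not> 3 dvd i \<and> \<not> 2 dvd j}\<close> and its
  transpose \<open>Q\<close> lie in the kernel, so every coset of the kernel contains the four sets obtained
  from \<open>S\<close> by adding \<open>0\<close>, \<open>P\<close>, \<open>Q\<close> or \<open>P + Q\<close>. A cell of \<open>P \<union> Q\<close> belongs to exactly two of them,
  so the smallest of the four has at most \<open>|V| - |P \<union> Q| / 2 = (6k - 1)\<^sup>2 - 10k\<^sup>2\<close> elements.
  If the kernel is spanned by \<open>P\<close> and \<open>Q\<close>, equality is attained by any \<open>S\<close> that contains
  all cells outside \<open>P \<union> Q\<close> and exactly half of each of \<open>P - Q\<close>, \<open>Q - P\<close>, \<open>P \<inter> Q\<close>.\<close>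

section \<open>Cardinalities of symmetric differences, and counting over periods\<close>

lemma odd_card_sym_diff:
  assumes "finite A" "finite B"
  shows "odd (card (sym_diff A B)) \<longleftrightarrow> odd (card A) \<noteq> odd (card B)"
proof -
  have "card (sym_diff A B) = card (A - B) + card (B - A)"
    using assms by (intro card_Un_disjoint) auto
  moreover have "card A = card (A - B) + card (A \<inter> B)"
    using assms by (subst card_Un_disjoint[symmetric]) (auto intro: arg_cong[where f = card])
  moreover have "card B = card (B - A) + card (A \<inter> B)"
    using assms by (subst card_Un_disjoint[symmetric]) (auto intro: arg_cong[where f = card])
  ultimately show ?thesis by auto
qed

text \<open>The part of \<open>P\<close> that is removed from \<open>S\<close> is as large as the
  part that is added. This gives all members of the extremal coset the same size.\<close>

lemma card_sym_diff_half:
  assumes "finite S" "finite P" "2 * card (S \<inter> P) = card P"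
  shows "card (sym_diff S P) = card S"
proof -
  have "card (sym_diff S P) = card (S - P) + card (P - S)"
    using assms by (intro card_Un_disjoint) auto
  moreover have "card S = card (S - P) + card (S \<inter> P)"
    using assms by (subst card_Un_disjoint[symmetric]) (auto intro: arg_cong[where f = card])
  moreover have "card P = card (P - S) + card (S \<inter> P)"
    using assms by (subst card_Un_disjoint[symmetric]) (auto intro: arg_cong[where f = card])
  ultimately show ?thesis using assms(3) by simp
qed

lemma sum_card_sym_diff_le:
  assumes "finite V" "S \<subseteq> V" "P \<subseteq> V" "Q \<subseteq> V"
  shows "card S + card (sym_diff S P) + card (sym_diff S Q) + card (sym_diff S (sym_diff P Q))
         + 2 * card (P \<union> Q) \<le> 4 * card V"
proof -
  have *: "card X = (\<Sum>v\<in>V. of_bool (v \<in> X))" if "X \<subseteq> V" for X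
    using that assms(1) by (simp add: Int_absorb1 Int_def[symmetric] Int_commute)
  have "(\<Sum>v\<in>V. of_bool (v \<in> S) + of_bool (v \<in> sym_diff S P) + of_bool (v \<in> sym_diff S Q)
          + of_bool (v \<in> sym_diff S (sym_diff P Q)) + 2 * of_bool (v \<in> P \<union> Q))
        \<le> (\<Sum>v\<in>V. 4 :: nat)"
    \<comment> \<open>At \<open>v\<close> in \<open>P \<union> Q\<close> exactly two of the four
      indicators are 1 and the last term adds 2; elsewhere the four indicators agree and the last
      term vanishes. Either way the total is at most 4.\<close>
    by (rule sum_mono) auto
  also have "\<dots> = 4 * card V" by simp
  finally have "(\<Sum>v\<in>V. of_bool (v \<in> S)) + (\<Sum>v\<in>V. of_bool (v \<in> sym_diff S P))
      + (\<Sum>v\<in>V. of_bool (v \<in> sym_diff S Q)) + (\<Sum>v\<in>V. of_bool (v \<in> sym_diff S (sym_diff P Q)))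
      + 2 * (\<Sum>v\<in>V. of_bool (v \<in> P \<union> Q)) \<le> 4 * card V"
    by (simp only: sum.distrib sum_distrib_left)
  moreover have "sym_diff S P \<subseteq> V" "sym_diff S Q \<subseteq> V" "sym_diff S (sym_diff P Q) \<subseteq> V" "P \<union> Q \<subseteq> V"
    using assms by blast+
  ultimately show ?thesis using *[OF assms(2)] by (simp only: *)
qed

lemma card_periodic:
  fixes P :: "nat \<Rightarrow> bool"
  assumes "\<And>i. P (i + p) = P i"
  shows "card {i. i < p * k \<and> P i} = k * card {i. i < p \<and> P i}"
proof (induction k)
  case (Suc k)
  have P: "P (p * k + i) = P i" for i
  proof (induction k)
    case (Suc k)
    then show ?case using assms[of "p * k + i"] by (simp add: algebra_simps)
  qed simp
  have "{i. i < p * Suc k \<and> P i}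
        = {i. i < p * k \<and> P i} \<union> (\<lambda>i. p * k + i) ` {i. i < p \<and> P i}" (is "_ = ?A \<union> ?B")
  proof (intro equalityI subsetI)
    fix i assume i: "i \<in> {i. i < p * Suc k \<and> P i}"
    show "i \<in> ?A \<union> ?B"
    proof (cases "i < p * k")
      case False
      then have "i = p * k + (i - p * k)" by simp
      moreover have "i - p * k < p" using i False by auto
      ultimately show ?thesis using i P by (metis (mono_tags, lifting) UnI2 image_eqI mem_Collect_eq)
    qed (use i in auto)
  qed (auto simp: P)
  moreover have "card (?A \<union> ?B) = card ?A + card ?B"
    by (rule card_Un_disjoint) auto
  moreover have "card ?B = card {i. i < p \<and> P i}"
    by (rule card_image) simp
  ultimately show ?case using Suc.IH by simp
qed simp

subsection \<open>Clicking on finite graphs\<close>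

text \<open>Additivity of the click map over the two-element field: intersecting with a closed
  neighborhood commutes with symmetric difference, and parity is additive. Finiteness matters
  because \<open>card\<close> of an infinite set is 0.\<close>

lemma toggled_sym_diff:
  assumes "finite S" "finite T"
  shows "toggled G (sym_diff S T) = sym_diff (toggled G S) (toggled G T)"
proof -
  have "odd (card (closed_nbhd G v \<inter> sym_diff S T))
    \<longleftrightarrow> odd (card (closed_nbhd G v \<inter> S)) \<noteq> odd (card (closed_nbhd G v \<inter> T))" for v
  proof -
    have "closed_nbhd G v \<inter> sym_diff S T = sym_diff (closed_nbhd G v \<inter> S) (closed_nbhd G v \<inter> T)"
      by blast
    then show ?thesis using assms odd_card_sym_diff[of "closed_nbhd G v \<inter> S"] by simp
  qed
  then show ?thesis unfolding toggled_def by blast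
qed

lemma finite_solutions: "finite (verts G) \<Longrightarrow> finite (solutions G C)"
  unfolding solutions_def by (rule finite_subset[of _ "Pow (verts G)"]) auto

lemma solutions_toggled_self: "S \<subseteq> verts G \<Longrightarrow> S \<in> solutions G (toggled G S)"
  by (simp add: solutions_def)

lemma most_clicks_le:
  assumes "finite (verts G)"
    and "\<And>S. S \<subseteq> verts G \<Longrightarrow> \<exists>T \<in> solutions G (toggled G S). card T \<le> n"
  shows "most_clicks G \<le> n"
proof -
  have "min_clicks G C \<le> n" if C: "solvable G C" for C
  proof -
    obtain S where "S \<subseteq> verts G" "toggled G S = C"
      using C unfolding solvable_def solutions_def by blast
    then obtain T where "T \<in> solutions G C" "card T \<le> n" using assms(2) by blast
    then show ?thesis
      unfolding min_clicks_def
      by (meson Min_le assms(1) finite_imageI finite_solutions image_eqI order_trans)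
  qed
  \<comment> \<open>A witness that the set under \<open>Max\<close> is nonempty, which
    \<open>Max_le_iff\<close> requires.\<close>
  moreover have "solvable G (toggled G {})" "toggled G {} \<subseteq> verts G"
    by (auto simp: solvable_def solutions_def toggled_def)
  moreover have "finite {C. C \<subseteq> verts G \<and> solvable G C}"
    using assms(1) by simp
  ultimately show ?thesis
    unfolding most_clicks_def by (subst Max_le_iff) auto
qed

lemma most_clicks_ge:
  assumes "finite (verts G)" "S \<subseteq> verts G"
    and "\<And>T. T \<in> solutions G (toggled G S) \<Longrightarrow> n \<le> card T"
  shows "n \<le> most_clicks G"
proof -
  have ne: "solutions G (toggled G S) \<noteq> {}"
    using solutions_toggled_self[OF assms(2)] by auto
  then have "n \<le> min_clicks G (toggled G S)"
    unfolding min_clicks_def using assms finite_solutions[OF assms(1)] by (subst Min_ge_iff) auto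
  also have "\<dots> \<le> most_clicks G"
    unfolding most_clicks_def using assms(1) ne
    by (intro Max_ge) (auto simp: solvable_def toggled_def)
  finally show ?thesis .
qed

section \<open>The size of the kernel\<close>

lemma card_span_F2_le:
  assumes "finite B"
  shows "finite (module.span scale_F2 B) \<and> card (module.span scale_F2 B) \<le> 2 ^ card B"
  using assms
proof (induction B)
  interpret vector_space scale_F2 by (rule vector_space_F2)
  case empty
  show ?case by simp
next
  interpret vector_space scale_F2 by (rule vector_space_F2)
  case (insert b B)
  let ?f = "\<lambda>(c, y). scale_F2 c b + y"
  have UNIV_bit: "(UNIV :: bit set) = {0, 1}" using bit_not_one_iff by auto
  \<comment> \<open>The coefficient of \<open>b\<close> has only two possible values, so adjoining
    \<open>b\<close> at most doubles the span.\<close>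
  have eq: "span (insert b B) \<subseteq> ?f ` (UNIV \<times> span B)"
  proof
    fix x assume "x \<in> span (insert b B)"
    then obtain c where "x - scale_F2 c b \<in> span B" by (auto simp: span_insert)
    then show "x \<in> ?f ` (UNIV \<times> span B)"
      by (intro image_eqI[of _ _ "(c, x - scale_F2 c b)"]) auto
  qed
  have fin: "finite ((UNIV :: bit set) \<times> span B)" using insert.IH by (simp add: UNIV_bit)
  have "card (span (insert b B)) \<le> card (?f ` (UNIV \<times> span B))"
    using eq fin by (intro card_mono) auto
  also have "\<dots> \<le> card ((UNIV :: bit set) \<times> span B)" using fin by (rule card_image_le)
  also have "\<dots> \<le> 2 * 2 ^ card B" using insert.IH by (simp add: card_cartesian_product UNIV_bit)
  finally show ?case using insert.hyps finite_subset[OF eq] fin by simp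
qed

text \<open>A basis of the kernel indicators has \<open>kernel_dim G\<close> elements, and its span
  contains all of them; passing from sets to indicators is injective, so the bound on the span
  carries over.\<close>

lemma card_kernel_le:
  assumes "finite (verts G)"
  shows "card {S. S \<subseteq> verts G \<and> toggled G S = {}} \<le> 2 ^ kernel_dim G"
proof -
  interpret vector_space scale_F2 by (rule vector_space_F2)
  let ?K = "{S. S \<subseteq> verts G \<and> toggled G S = {}}"
  obtain B where B: "B \<subseteq> indicator_F2 ` ?K" "independent B" "indicator_F2 ` ?K \<subseteq> span B"
      "card B = dim (indicator_F2 ` ?K)"
    by (rule basis_exists)
  have "finite ?K" using assms by simp
  then have "finite B" using B(1) finite_subset by blast
  have "inj indicator_F2"
    by (rule injI) (simp add: indicator_F2_def fun_eq_iff set_eq_iff of_bool_eq_iff)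
  then have "inj_on indicator_F2 ?K" by (rule inj_on_subset) simp
  then have "card ?K = card (indicator_F2 ` ?K)" by (rule card_image[symmetric])
  also have "\<dots> \<le> card (span B)" using card_span_F2_le[OF \<open>finite B\<close>] B(3) by (intro card_mono) auto
  also have "\<dots> \<le> 2 ^ card B" using card_span_F2_le[OF \<open>finite B\<close>] by blast
  finally show ?thesis by (simp add: B(4) kernel_dim_def)
qed

text \<open>Dimension 2 allows at most four kernel elements, and the four listed sets are distinct
  members, so they exhaust it.\<close>

lemma kernel_eqI:
  assumes "finite (verts G)" "kernel_dim G = 2"
    and "P \<subseteq> verts G" "toggled G P = {}" "Q \<subseteq> verts G" "toggled G Q = {}"
    and "P \<noteq> {}" "Q \<noteq> {}" "P \<noteq> Q"
  shows "{S. S \<subseteq> verts G \<and> toggled G S = {}} = {{}, P, Q, sym_diff P Q}"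
proof (rule card_seteq[symmetric])
  have fin: "finite P" "finite Q" using assms finite_subset by blast+
  have "toggled G (sym_diff P Q) = {}"
    unfolding toggled_sym_diff[OF fin] using assms by simp
  then show "{{}, P, Q, sym_diff P Q} \<subseteq> {S. S \<subseteq> verts G \<and> toggled G S = {}}"
    using assms(3-6) by (auto simp: toggled_def)
  have "sym_diff P Q \<noteq> {}" "sym_diff P Q \<noteq> P" "sym_diff P Q \<noteq> Q" using assms(7-9) by blast+
  then have "card {{}, P, Q, sym_diff P Q} = 4"
    using assms(7-9) by (simp add: eq_commute)
  then show "card {S. S \<subseteq> verts G \<and> toggled G S = {}} \<le> card {{}, P, Q, sym_diff P Q}"
    using card_kernel_le[OF assms(1)] by (simp add: assms(2))
qed (use assms(1) in simp)

subsection \<open>Two kernel elements of the grid\<close>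

lemma verts_grid: "verts (grid_graph m) = {..<m} \<times> {..<m}"
  by (simp add: grid_graph_def Let_def)

text \<open>Writing \<open>j = Suc b\<close> and \<open>i = Suc a\<close> for the lower neighbors
  avoids truncated subtraction at the border.\<close>

lemma closed_nbhd_grid:
  assumes "i < m" "j < m"
  shows "closed_nbhd (grid_graph m) (i, j) =
    {(a, b). a < m \<and> b < m \<and>
       (a = i \<and> (b = j \<or> b = Suc j \<or> j = Suc b) \<or> b = j \<and> (a = Suc i \<or> i = Suc a))}"
  using assms by (auto simp: closed_nbhd_def grid_graph_def Let_def doubleton_eq_iff)

text \<open>Transposition is an automorphism of the square grid, so the transpose of a kernel
  element is again one.\<close>

lemma toggled_grid_swap:
  "toggled (grid_graph m) (prod.swap ` S) = prod.swap ` toggled (grid_graph m) S"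
proof -
  have "card (closed_nbhd (grid_graph m) (i, j) \<inter> prod.swap ` S)
      = card (closed_nbhd (grid_graph m) (j, i) \<inter> S)" if "i < m" "j < m" for i j
  proof -
    have "closed_nbhd (grid_graph m) (i, j) \<inter> prod.swap ` S
        = prod.swap ` (closed_nbhd (grid_graph m) (j, i) \<inter> S)"
      using that by (auto simp: closed_nbhd_grid)
    then show ?thesis by (simp add: card_image)
  qed
  then show ?thesis by (auto simp: toggled_def verts_grid image_iff)
qed

text \<open>The set \<open>P\<close> of the overview; \<open>Suc\<close> translates zero-based
  indices into the numbering from 1.\<close>

definition stripes :: "nat \<Rightarrow> (nat \<times> nat) set" where
  "stripes m = {i. i < m \<and> \<not> 3 dvd Suc i} \<times> {j. j < m \<and> odd (Suc j)}"

text \<open>The indicator is a product x_i * y_j with x = 1,1,0,1,1,0,... and y = 1,0,1,0,....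
  Modulo 2, x_(i-1) + x_i + x_(i+1) = 0 and y_(j-1) + y_(j+1) = 0, so the sum over a closed
  neighborhood vanishes. At the far border this needs both patterns to continue with 0, which
  divisibility of \<open>Suc m\<close> by 3 and by 2 provides.\<close>

lemma toggled_stripes:
  assumes "6 dvd Suc m"
  shows "toggled (grid_graph m) (stripes m) = {}"
proof -
  have "even (card (closed_nbhd (grid_graph m) (i, j) \<inter> stripes m))" if ij: "i < m" "j < m" for i j
  proof (cases "even j")
    case True
    consider "i mod 3 = 0" | "i mod 3 = 1" | "i mod 3 = 2" by linarith
    then show ?thesis
    proof cases
      case 1
      \<comment> \<open>Since \<open>3 dvd Suc m\<close>, the last index \<open>m - 1\<close> is 1
        modulo 3, so indices in the other two classes have a successor inside the grid.\<close>
      then have "Suc i < m" using assms ij by presburger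
      then have "closed_nbhd (grid_graph m) (i, j) \<inter> stripes m = {(i, j), (Suc i, j)}"
        using 1 True ij by (auto simp: closed_nbhd_grid stripes_def; presburger)
      then show ?thesis by simp
    next
      case 2
      then obtain a where "i = Suc a" by (cases i) auto
      then have "closed_nbhd (grid_graph m) (i, j) \<inter> stripes m = {(a, j), (i, j)}"
        using 2 True ij by (auto simp: closed_nbhd_grid stripes_def; presburger)
      then show ?thesis using \<open>i = Suc a\<close> by simp
    next
      case 3
      then obtain a where "i = Suc a" by (cases i) auto
      moreover have "Suc i < m" using 3 assms ij by presburger
      ultimately have "closed_nbhd (grid_graph m) (i, j) \<inter> stripes m = {(a, j), (Suc i, j)}"
        using 3 True ij by (auto simp: closed_nbhd_grid stripes_def; presburger)
      then show ?thesis using \<open>i = Suc a\<close> by simp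
    qed
  next
    case False
    then obtain b where b: "j = Suc b" by (cases j) auto
    \<comment> \<open>\<open>m\<close> is odd, so the last index is even and an odd \<open>j\<close>
      is not the last.\<close>
    have "Suc j < m" using False assms ij by presburger
    then have "closed_nbhd (grid_graph m) (i, j) \<inter> stripes m
        = (if 3 dvd Suc i then {} else {(i, b), (i, Suc j)})"
      using b False ij by (auto simp: closed_nbhd_grid stripes_def)
    then show ?thesis using b by simp
  qed
  then show ?thesis by (auto simp: toggled_def verts_grid)
qed

text \<open>All three conditions have period 6, with 4, 3 and 2 hits per period: the residues
  0,1,3,4, then 0,2,4, then 0,4.\<close>

lemma card_stripe_sets:
  assumes "Suc m = 6 * k"
  shows "card {i. i < m \<and> \<not> 3 dvd Suc i} = 4 * k" (is ?T)
    and "card {i. i < m \<and> odd (Suc i)} = 3 * k" (is ?E)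
    and "card ({i. i < m \<and> \<not> 3 dvd Suc i} \<inter> {i. i < m \<and> odd (Suc i)}) = 2 * k" (is ?I)
proof -
  have less6: "card {i. i < 6 \<and> R i} = of_bool (R 0) + of_bool (R 1) + of_bool (R 2)
      + of_bool (R 3) + of_bool (R 4) + of_bool (R (5 :: nat))" for R
  proof -
    have "{i. i < 6 \<and> R i} = {i \<in> {0, 1, 2, 3, 4, 5}. R i}" by auto
    then have "card {i. i < 6 \<and> R i} = (\<Sum>i\<in>{0, 1, 2, 3, 4, 5}. if R i then 1 else 0)"
      by (simp only: card_eq_sum sum.inter_filter finite.intros)
    then show ?thesis by (simp add: of_bool_def)
  qed
  \<comment> \<open>The range below \<open>m\<close> is one short of \<open>k\<close> full periods;
    the missing index \<open>m\<close> itself violates the condition, so including it changes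
    nothing.\<close>
  have drop: "{i. i < m \<and> R i} = {i. i < 6 * k \<and> R i}" if "\<not> R m" for R
    using that assms[symmetric] by (auto simp: less_Suc_eq)
  have count: "card {i. i < m \<and> R i} = k * card {i. i < 6 \<and> R i}"
    if "\<not> R m" "\<And>i. R (i + 6) = R i" for R
    unfolding drop[of R, OF that(1)] by (rule card_periodic) (rule that(2))
  have m: "3 dvd Suc m" "even (Suc m)" using assms by presburger+
  have period: "3 dvd Suc (i + 6) \<longleftrightarrow> 3 dvd Suc i" for i by presburger
  show ?T using count[of "\<lambda>i. \<not> 3 dvd Suc i"] m(1) period by (simp add: less6 flip: numeral_2_eq_2)
  show ?E using count[of "\<lambda>i. odd (Suc i)"] m(2) by (simp add: less6)
  have "{i. i < m \<and> \<not> 3 dvd Suc i} \<inter> {i. i < m \<and> odd (Suc i)}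
      = {i. i < m \<and> (\<not> 3 dvd Suc i \<and> odd (Suc i))}" by blast
  then show ?I using count[of "\<lambda>i. \<not> 3 dvd Suc i \<and> odd (Suc i)"] m period
    by (simp add: less6 flip: numeral_2_eq_2)
qed

lemma card_stripes:
  assumes "Suc m = 6 * k"
  shows "card (stripes m) = 12 * k\<^sup>2" "card (prod.swap ` stripes m) = 12 * k\<^sup>2"
    and "card (stripes m \<inter> prod.swap ` stripes m) = 4 * k\<^sup>2"
proof -
  show *: "card (stripes m) = 12 * k\<^sup>2"
    unfolding stripes_def card_cartesian_product card_stripe_sets[OF assms]
    by (simp add: power2_eq_square)
  then show "card (prod.swap ` stripes m) = 12 * k\<^sup>2" by (simp add: card_image)
  \<comment> \<open>In the intersection each coordinate has to satisfy both conditions, so it is a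
    square over the third index set.\<close>
  have "stripes m \<inter> prod.swap ` stripes m
      = ({i. i < m \<and> \<not> 3 dvd Suc i} \<inter> {i. i < m \<and> odd (Suc i)})
        \<times> ({i. i < m \<and> \<not> 3 dvd Suc i} \<inter> {i. i < m \<and> odd (Suc i)})"
    by (auto simp: stripes_def image_iff)
  then show "card (stripes m \<inter> prod.swap ` stripes m) = 4 * k\<^sup>2"
    by (simp only: card_cartesian_product card_stripe_sets[OF assms]) (simp add: power2_eq_square)
qed

section \<open>The upper bound and its sharpness\<close>

theorem theorem3:
  fixes k :: nat
  assumes "k > 0"
  shows "int (most_clicks (grid_graph (6 * k - 1))) \<le> 26 * (int k)\<^sup>2 - 12 * int k + 1 \<and>
    (d_grid (6 * k - 1) = 2 \<longrightarrow>
      int (most_clicks (grid_graph (6 * k - 1))) = 26 * (int k)\<^sup>2 - 12 * int k + 1)"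
proof -
  define m where "m = 6 * k - 1"
  define G where "G = grid_graph m"
  define P where "P = stripes m"
  define Q where "Q = prod.swap ` stripes m"
  define n where "n = m * m - 10 * k\<^sup>2"
  have m: "Suc m = 6 * k" using assms by (simp add: m_def)
  have V: "verts G = {..<m} \<times> {..<m}" by (simp add: G_def verts_grid)
  have finV: "finite (verts G)" and cardV: "card (verts G) = m * m" by (simp_all add: V)
  have PV: "P \<subseteq> verts G" and QV: "Q \<subseteq> verts G"
    by (auto simp: P_def Q_def stripes_def V)
  have fin: "finite P" "finite Q" using PV QV finV finite_subset by blast+
  have cP: "card P = 12 * k\<^sup>2" and cQ: "card Q = 12 * k\<^sup>2" and cPQ: "card (P \<inter> Q) = 4 * k\<^sup>2"
    using card_stripes[OF m] by (simp_all add: P_def Q_def)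
  have cU: "card (P \<union> Q) = 20 * k\<^sup>2"
    using card_Un_Int[OF fin] cP cQ cPQ by simp
  have cPm: "card (P - Q) = 8 * k\<^sup>2" and cQm: "card (Q - P) = 8 * k\<^sup>2"
    using cP cQ cPQ fin by (simp_all add: card_Diff_subset_Int Int_commute)
  have tP: "toggled G P = {}" and tQ: "toggled G Q = {}"
    using m by (simp_all add: G_def P_def Q_def toggled_grid_swap toggled_stripes)
  \<comment> \<open>This ensures that the natural subtraction defining \<open>n\<close> is not
    truncated.\<close>
  have "20 * k\<^sup>2 \<le> m * m"
    using card_mono[OF finV, of "P \<union> Q"] PV QV cU cardV by simp
  then have n: "n + 10 * k\<^sup>2 = m * m" by (simp add: n_def)
  have int_n: "int n = 26 * (int k)\<^sup>2 - 12 * int k + 1"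
  proof -
    have "int n = int m * int m - 10 * (int k)\<^sup>2" using arg_cong[OF n, of int] by simp
    moreover have "int m = 6 * int k - 1" using m by linarith
    ultimately show ?thesis by (simp add: power2_eq_square algebra_simps)
  qed
  have upper: "most_clicks G \<le> n"
  proof (rule most_clicks_le[OF finV])
    fix S assume S: "S \<subseteq> verts G"
    then have finS: "finite S" using finV finite_subset by blast
    have sol: "sym_diff S R \<in> solutions G (toggled G S)"
      if "R \<subseteq> verts G" "toggled G R = {}" for R
    proof -
      have "finite R" using that finV finite_subset by blast
      then have "toggled G (sym_diff S R) = toggled G S"
        by (simp only: toggled_sym_diff[OF finS] that) simp
      then show ?thesis using S that(1) by (auto simp: solutions_def)
    qed
    have "toggled G (sym_diff P Q) = {}"
      by (simp only: toggled_sym_diff[OF fin] tP tQ) simp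
    then have sols: "S \<in> solutions G (toggled G S)" "sym_diff S P \<in> solutions G (toggled G S)"
      "sym_diff S Q \<in> solutions G (toggled G S)"
      "sym_diff S (sym_diff P Q) \<in> solutions G (toggled G S)"
      using sol PV QV tP tQ solutions_toggled_self[OF S] by (blast intro!: sol)+
    \<comment> \<open>The four sizes average at most \<open>n\<close>, because 4 * m * m - 2 * 20 *
      k^2 = 4 * n; hence one of them is at most \<open>n\<close>.\<close>
    have "card S + card (sym_diff S P) + card (sym_diff S Q) + card (sym_diff S (sym_diff P Q))
        \<le> 4 * n"
      using sum_card_sym_diff_le[OF finV S PV QV] cU cardV n by linarith
    then have "card S \<le> n \<or> card (sym_diff S P) \<le> n \<or> card (sym_diff S Q) \<le> n
        \<or> card (sym_diff S (sym_diff P Q)) \<le> n"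
      by linarith
    then show "\<exists>T \<in> solutions G (toggled G S). card T \<le> n" using sols by blast
  qed
  have lower: "n \<le> most_clicks G" if "kernel_dim G = 2"
  proof -
    have "P \<noteq> {}" "Q \<noteq> {}" using cP cQ assms by auto
    moreover have "P \<noteq> Q" using cPm assms by auto
    ultimately have kernel: "{S. S \<subseteq> verts G \<and> toggled G S = {}} = {{}, P, Q, sym_diff P Q}"
      by (intro kernel_eqI finV that PV QV tP tQ)
    \<comment> \<open>\<open>P\<close>, \<open>Q\<close> and \<open>sym_diff P Q\<close> are each a
      disjoint union of two of the pieces \<open>P - Q\<close>, \<open>Q - P\<close>,
      \<open>P \<inter> Q\<close>, of sizes 8 * k^2, 8 * k^2 and 4 * k^2. Taking half of every piece
      therefore halves all three sets at once.\<close>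
    obtain A where A: "A \<subseteq> P - Q" "card A = 4 * k\<^sup>2" "finite A"
      by (rule obtain_subset_with_card_n[of "4 * k\<^sup>2" "P - Q"]) (simp_all add: cPm)
    obtain B where B: "B \<subseteq> Q - P" "card B = 4 * k\<^sup>2" "finite B"
      by (rule obtain_subset_with_card_n[of "4 * k\<^sup>2" "Q - P"]) (simp_all add: cQm)
    obtain C where C: "C \<subseteq> P \<inter> Q" "card C = 2 * k\<^sup>2" "finite C"
      by (rule obtain_subset_with_card_n[of "2 * k\<^sup>2" "P \<inter> Q"]) (simp_all add: cPQ)
    have finABC: "finite A" "finite B" "finite C" by fact+
    have disj: "A \<inter> B = {}" "A \<inter> C = {}" "B \<inter> C = {}" using A(1) B(1) C(1) by blast+
    define S where "S = (verts G - (P \<union> Q)) \<union> (A \<union> B \<union> C)"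
    have S: "S \<subseteq> verts G" unfolding S_def using A(1) B(1) C(1) PV QV by blast
    have finS: "finite S" using S finV finite_subset by blast
    have "card S = card (verts G - (P \<union> Q)) + card (A \<union> B \<union> C)"
      unfolding S_def using finV finABC A(1) B(1) C(1) by (intro card_Un_disjoint) auto
    moreover have "card (verts G - (P \<union> Q)) + 20 * k\<^sup>2 = m * m"
      using card_Diff_subset[of "P \<union> Q" "verts G"] PV QV fin cU cardV \<open>20 * k\<^sup>2 \<le> m * m\<close> by simp
    moreover have "card (A \<union> B \<union> C) = 10 * k\<^sup>2"
      using A B C finABC disj by (simp add: card_Un_disjoint Int_Un_distrib2)
    ultimately have cardS: "card S = n" using n by linarith
    have "S \<inter> P = A \<union> C" "S \<inter> Q = B \<union> C" "S \<inter> sym_diff P Q = A \<union> B"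
      unfolding S_def using A(1) B(1) C(1) by blast+
    then have "2 * card (S \<inter> P) = card P" "2 * card (S \<inter> Q) = card Q"
      "2 * card (S \<inter> sym_diff P Q) = card (sym_diff P Q)"
      using A B C finABC disj cP cQ cPm cQm fin
      by (simp_all add: card_Un_disjoint) (subst card_Un_disjoint; auto)
    then have same: "card (sym_diff S P) = n" "card (sym_diff S Q) = n"
      "card (sym_diff S (sym_diff P Q)) = n"
      using card_sym_diff_half[OF finS] fin cardS by (metis finite_Diff finite_Un)+
    show ?thesis
    proof (rule most_clicks_ge[OF finV S])
      fix T assume "T \<in> solutions G (toggled G S)"
      then have T: "T \<subseteq> verts G" "toggled G T = toggled G S" by (auto simp: solutions_def)
      then have "finite T" using finV finite_subset by blast
      \<comment> \<open>Two solutions of one configuration differ by a kernel element, so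
        \<open>T\<close> is one of the four sets already shown to have \<open>n\<close>
        elements.\<close>
      then have "toggled G (sym_diff S T) = {}"
        by (simp only: toggled_sym_diff[OF finS] T) simp
      then have "sym_diff S T \<in> {{}, P, Q, sym_diff P Q}"
        unfolding kernel[symmetric] using S T(1) by blast
      moreover have "T = sym_diff S (sym_diff S T)" by blast
      ultimately have "T = S \<or> T = sym_diff S P \<or> T = sym_diff S Q
          \<or> T = sym_diff S (sym_diff P Q)"
        by (smt (verit) Diff_empty Un_empty_right empty_Diff insertE singletonD)
      then show "n \<le> card T" using same cardS by auto
    qed
  qed
  show ?thesis
    using upper lower int_n unfolding d_grid_def G_def m_def by (metis le_antisym of_nat_le_iff)
qed

end
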